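(* The $\mathcal T$-semantics, which assigns to each program module $\mathcal P$ the operator $\mathcal T_{\mathcal P}$, is compositional with respect to $(Ob,\{\cup,\overline{(\cdot)}^{\sigma},(\cdot)\setminus\sigma,\rho(\cdot)\})$. That is, writing $\mathcal P\equiv_T\mathcal Q$ for $\mathcal T_{\mathcal P}=\mathcal T_{\mathcal Q}$, for all modules over $\Sigma$: $\mathcal P\equiv_T\mathcal Q$ implies $Ob(\mathcal P)=Ob(\mathcal Q)$; $\mathcal P_i\equiv_T\mathcal Q_i$ ($i=1,2$) implies $\mathcal P_1\cup\mathcal P_2\equiv_T\mathcal Q_1\cup\mathcal Q_2$; and $\mathcal P\equiv_T\mathcal Q$ implies $\overline{\mathcal P}^{\sigma}\equiv_T\overline{\mathcal Q}^{\sigma}$, $\mathcal P\setminus\sigma\equiv_T\mathcal Q\setminus\sigma$ and $\rho(\mathcal P)\equiv_T\rho(\mathcal Q)$ for every $\sigma\subseteq FS_\Sigma$ and every function symbol renaming $\rho$.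
   Context: Terms. $\Sigma=(DS_\Sigma,FS_\Sigma)$ consists of countable disjoint sets of constructor symbols and of (defined) function symbols, each with an arity; $DS^n_\Sigma$, $FS^n_\Sigma$ are the symbols of arity $n\ge 0$. $\mathcal V$ is a countably infinite set of variables; $\bot$ is an extra 0-ary constructor. $\mathbf{Term}_\bot$ is the set of terms over $DS_\Sigma\cup FS_\Sigma\cup\{\bot\}$ and $\mathcal V$; $\mathbf{CTerm}_\bot$ is the subset of terms without function symbols; $\mathbf{Term}$, $\mathbf{CTerm}$ are the respective subsets of terms not containing $\bot$. $\mathbf{CSubst}_\bot$ is the set of maps $\theta:\mathcal V\to\mathbf{CTerm}_\bot$, extended to terms and written $t\theta$. Formulas are reduction statements $a\to b$ and joinability statements $a\bowtie b$ with $a,b\in\mathbf{Term}_\bot$. $\sqsubseteq$ is the least partial order on $\mathbf{CTerm}_\bot$ with $\bot\sqsubseteq t$ and $c(\overline s)\sqsubseteq c(\overline t)$ whenever $c\in DS^n_\Sigma$ and $s_i\sqsubseteq t_i$ for all $i$; $\langle t\rangle=\{s\in\mathbf{CTerm}_\bot\mid s\sqsubseteq t\}$. A cone is a non-empty subset of $\mathbf{CTerm}_\bot$ closed downwards under $\sqsubseteq$. Programs. A program is a set $\mathcal R$ of rules $f(\overline t)\to r\Leftarrow C$ with $f\in FS^n_\Sigma$, $\overline t$ an $n$-tuple of terms of $\mathbf{CTerm}$ in which no variable occurs twice, $r\in\mathbf{Term}_\bot$, and $C$ a finite set of joinability statements between terms of $\mathbf{Term}$. $[\mathcal R]_\bot$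 is the set of all instances $(l\to r\Leftarrow C)\theta$ of rules of $\mathcal R$ with $\theta\in\mathbf{CSubst}_\bot$. Provability. $\mathcal R\vdash_{CRWL}\varphi$ means $\varphi$ is derivable with: (Bo) $e\to\bot$ for $e\in\mathbf{Term}_\bot$; (RR) $e\to e$ for $e\in\mathcal V\cup DS^0_\Sigma$; (DS) from $e_i\to t_i$ ($1\le i\le n$) infer $c(\overline e)\to c(\overline t)$, for $c\in DS^n_\Sigma$; (OR) from $e_i\to t_i$ ($1\le i\le n$), all statements of $C$, and $r\to t$ infer $f(\overline e)\to t$, if $(f(\overline t)\to r\Leftarrow C)\in[\mathcal R]_\bot$ and $t\neq\bot$; (Jo) from $a\to t$ and $b\to t$ infer $a\bowtie b$, if $t\in\mathbf{CTerm}$. Term algebras. A (CRWL-)term algebra $\mathcal A$ has carrier $\mathbf{CTerm}_\bot$, interprets each $c\in DS^n_\Sigma$ by $c^{\mathcal A}(\overline t)=\langle c(\overline t)\rangle$, and each $f\in FS^n_\Sigma$ by a monotonic map $f^{\mathcal A}$ from $(\mathbf{CTerm}_\bot)^n$ to cones ordered by inclusion (a cone if $n=0$). $\mathbf{TAlg}_\Sigma$ is the set of them. Evaluation under $\eta:\mathcal V\to\mathbf{CTerm}_\bot$: $[\![\bot]\!]^{\mathcal A}_\eta=\langle\bot\rangle$, $[\![X]\!]^{\mathcal A}_\eta=\langle\eta(X)\rangle$, $[\![h(e_1,\dots,e_n)]\!]^{\mathcal A}_\eta=\bigcup\{h^{\mathcal A}(u_1,\dots,u_n)\mid u_i\in[\![e_i]\!]^{\mathcal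 A}_\eta\}$. $id$ is the identity valuation. $\mathcal A\models_\eta a\bowtie b$ iff $[\![a]\!]^{\mathcal A}_\eta\cap[\![b]\!]^{\mathcal A}_\eta$ contains an element of $\mathbf{CTerm}$ (a maximal element); $\mathcal A\models_\eta C$ iff this holds for all statements of $C$. For a program $\mathcal R$, $\mathcal T_{\mathcal R}:\mathbf{TAlg}_\Sigma\to\mathbf{TAlg}_\Sigma$ is given by $f^{\mathcal T_{\mathcal R}(\mathcal A)}(\overline t)=\{t\mid\exists(f(\overline s)\to r\Leftarrow C)\in[\mathcal R]_\bot,\ s_i\sqsubseteq t_i\text{ for all }i,\ \mathcal A\models_{id}C,\ t\in[\![r]\!]^{\mathcal A}_{id}\}\cup\{\bot\}$. $\mathcal M_{\mathcal R}$ is the term algebra with $f^{\mathcal M_{\mathcal R}}(\overline t)=\{r\in\mathbf{CTerm}_\bot\mid\mathcal R\vdash_{CRWL}f(\overline t)\to r\}$. Modules. A module is $\mathcal P=\langle\sigma_p,\sigma_e,\mathcal R\rangle$ with $\mathcal R$ a program whose rules have right-hand sides $r\ne\bot$, $\sigma_e=exp(\mathcal P)$ the set of function symbols having a defining rule in $\mathcal R$, and $\sigma_p$ the set of function symbols occurring in $\mathcal R$ without a defining rule in $\mathcal R$; $rl(\mathcal P)=\mathcal R$, and $\mathcal T_{\mathcal P}$, $\mathcal M_{\mathcal P}$ mean $\mathcal T_{rl(\mathcal P)}$, $\mathcal M_{rl(\mathcal P)}$. A module is determined by its rules. Operations: - union: $rl(\mathcal P_1\cup\mathcal P_2)=rl(\mathcal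 P_1)\cup rl(\mathcal P_2)$; - deletion: $rl(\mathcal P\setminus\sigma)$ is the set of rules of $\mathcal P$ that define function symbols not in $\sigma$; - closure: $rl(\overline{\mathcal P}^{\sigma})=\{crr(f(\overline t),r)\mid f\in\sigma,\ t_i\in\mathbf{CTerm}_\bot,\ r\in\mathbf{CTerm}_\bot,\ r\ne\bot,\ rl(\mathcal P)\vdash_{CRWL}f(\overline t)\to r\}$, where $crr(f(\overline t),r)$ is the rule $f(\overline t')\to r\Leftarrow C$ obtained by replacing in $\overline t$ each occurrence of $\bot$ and each occurrence other than the first of a variable occurring more than once by a distinct fresh variable, and letting $C$ consist of $X\bowtie Y$ for each fresh $Y$ replacing an occurrence of a repeated variable $X$, and $X\bowtie X$ for each variable $X$ of $r$ and each variable $X$ occurring exactly once in $\overline t$; - renaming: a function symbol renaming is a map $\rho:FS_\Sigma\to FS_\Sigma$ preserving arities; it acts on terms and rules by replacing every function symbol $f$ by $\rho(f)$ (constructors, variables and $\bot$ fixed), and $rl(\rho(\mathcal P))=\{\rho(R)\mid R\in rl(\mathcal P)\}$. Observation: $Ob(\mathcal P)=\mathcal M_{\mathcal P}$. *)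

theory Defs
  imports Main "HOL-Library.FuncSet" "HOL-Library.Countable_Set"
begin

section \<open>Signatures and terms\<close>

text \<open>Constructor and function symbols live in different types, hence are automatically disjoint;
  \<open>Bot\<close> is the additional constant \<open>\<bottom>\<close>.\<close>

record ('c, 'f) signature =
  DS :: "'c set"
  FS :: "'f set"
  arD :: "'c \<Rightarrow> nat"
  arF :: "'f \<Rightarrow> nat"

definition is_signature :: "('c, 'f) signature \<Rightarrow> bool" where
  "is_signature S \<longleftrightarrow> countable (DS S) \<and> countable (FS S)"

datatype (csyms: 'c, fsyms: 'f, vars: 'v) trm =
    Bot
  | Var 'v
  | Con 'c "('c, 'f, 'v) trm list"
  | Fun 'f "('c, 'f, 'v) trm list"

inductive_set Term_bot :: "('c, 'f) signature \<Rightarrow> ('c, 'f, 'v) trm set"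
  for S :: "('c, 'f) signature" where
  "Bot \<in> Term_bot S"
| "Var x \<in> Term_bot S"
| "c \<in> DS S \<Longrightarrow> length ts = arD S c \<Longrightarrow> (\<And>t. t \<in> set ts \<Longrightarrow> t \<in> Term_bot S) \<Longrightarrow> Con c ts \<in> Term_bot S"
| "f \<in> FS S \<Longrightarrow> length ts = arF S f \<Longrightarrow> (\<And>t. t \<in> set ts \<Longrightarrow> t \<in> Term_bot S) \<Longrightarrow> Fun f ts \<in> Term_bot S"

fun bot_free :: "('c, 'f, 'v) trm \<Rightarrow> bool" where
  "bot_free Bot \<longleftrightarrow> False"
| "bot_free (Var x) \<longleftrightarrow> True"
| "bot_free (Con c ts) \<longleftrightarrow> (\<forall>t\<in>set ts. bot_free t)"
| "bot_free (Fun f ts) \<longleftrightarrow> (\<forall>t\<in>set ts. bot_free t)"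

definition CTerm_bot :: "('c, 'f) signature \<Rightarrow> ('c, 'f, 'v) trm set" where
  "CTerm_bot S = {t \<in> Term_bot S. fsyms t = {}}"

definition Term :: "('c, 'f) signature \<Rightarrow> ('c, 'f, 'v) trm set" where
  "Term S = {t \<in> Term_bot S. bot_free t}"

definition CTerm :: "('c, 'f) signature \<Rightarrow> ('c, 'f, 'v) trm set" where
  "CTerm S = {t \<in> CTerm_bot S. bot_free t}"

definition tuples :: "('c, 'f) signature \<Rightarrow> nat \<Rightarrow> ('c, 'f, 'v) trm list set" where
  "tuples S n = {ts. length ts = n \<and> set ts \<subseteq> CTerm_bot S}"

text \<open>The variable occurrences of a term, from left to right and with repetitions.\<close>

primrec var_occs :: "('c, 'f, 'v) trm \<Rightarrow> 'v list" where
  "var_occs Bot = []"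
| "var_occs (Var x) = [x]"
| "var_occs (Con c ts) = concat (map var_occs ts)"
| "var_occs (Fun f ts) = concat (map var_occs ts)"

definition tuple_occs :: "('c, 'f, 'v) trm list \<Rightarrow> 'v list" where
  "tuple_occs ts = concat (map var_occs ts)"

primrec subst :: "('v \<Rightarrow> ('c, 'f, 'v) trm) \<Rightarrow> ('c, 'f, 'v) trm \<Rightarrow> ('c, 'f, 'v) trm" where
  "subst \<theta> Bot = Bot"
| "subst \<theta> (Var x) = \<theta> x"
| "subst \<theta> (Con c ts) = Con c (map (subst \<theta>) ts)"
| "subst \<theta> (Fun f ts) = Fun f (map (subst \<theta>) ts)"

definition CSubst_bot :: "('c, 'f) signature \<Rightarrow> ('v \<Rightarrow> ('c, 'f, 'v) trm) set" where
  "CSubst_bot S = UNIV \<rightarrow> CTerm_bot S"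


section \<open>Approximation order and cones\<close>

text \<open>The least reflexive and transitive relation on \<open>CTerm_bot\<close> that satisfies the two closure
  conditions. It is antisymmetric (lemma \<open>approx_antisym\<close>), hence the least such partial order.\<close>

inductive approx :: "('c, 'f) signature \<Rightarrow> ('c, 'f, 'v) trm \<Rightarrow> ('c, 'f, 'v) trm \<Rightarrow> bool"
  for S :: "('c, 'f) signature" where
  approx_refl: "t \<in> CTerm_bot S \<Longrightarrow> approx S t t"
| approx_trans: "approx S s t \<Longrightarrow> approx S t u \<Longrightarrow> approx S s u"
| approx_Bot: "t \<in> CTerm_bot S \<Longrightarrow> approx S Bot t"
| approx_Con: "c \<in> DS S \<Longrightarrow> length ss = arD S c \<Longrightarrow> list_all2 (approx S) ss ts
    \<Longrightarrow> approx S (Con c ss) (Con c ts)"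

lemma approx_inv:
  "approx S s t \<Longrightarrow> (case s of Bot \<Rightarrow> True | Var x \<Rightarrow> t = Var x
     | Con c ss \<Rightarrow> (\<exists>ts. t = Con c ts \<and> list_all2 (approx S) ss ts) | Fun f ss \<Rightarrow> False)"
proof (induction rule: approx.induct)
  case (approx_refl t)
  show ?case
  proof (cases t)
    case (Con c ts)
    with approx_refl have "\<forall>u\<in>set ts. u \<in> CTerm_bot S"
      by (auto simp: CTerm_bot_def elim: Term_bot.cases)
    then have "list_all2 (approx S) ts ts"
      by (auto simp: list_all2_same intro: approx.approx_refl)
    with Con show ?thesis by simp
  qed (use approx_refl in \<open>auto simp: CTerm_bot_def\<close>)
next
  case (approx_trans s t u)
  show ?case
  proof (cases s)
    case (Con c ss)
    with approx_trans.IH obtain ts us where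
      "list_all2 (approx S) ss ts" "u = Con c us" "list_all2 (approx S) ts us"
      by auto
    with Con show ?thesis
      by (auto intro: list_all2_trans[rotated] approx.approx_trans)
  qed (use approx_trans.IH in auto)
next
  case (approx_Con c ss ts)
  then show ?case by (auto elim: list_all2_mono)
qed auto

lemma approx_antisym: "approx S s t \<Longrightarrow> approx S t s \<Longrightarrow> s = t"
proof (induction s arbitrary: t)
  case Bot
  then show ?case by (cases t) (auto dest: approx_inv)
next
  case (Var x)
  then show ?case by (auto dest: approx_inv)
next
  case (Con c ss)
  from approx_inv[OF Con.prems(1)] obtain ts where ts: "t = Con c ts" "list_all2 (approx S) ss ts"
    by auto
  with approx_inv[OF Con.prems(2)] have "list_all2 (approx S) ts ss"
    by auto
  with ts Con.IH have "ss = ts"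
    by (auto simp: list_all2_conv_all_nth intro!: nth_equalityI)
  with ts show ?case by simp
next
  case (Fun f ss)
  from approx_inv[OF Fun.prems(1)] show ?case by simp
qed

definition down :: "('c, 'f) signature \<Rightarrow> ('c, 'f, 'v) trm \<Rightarrow> ('c, 'f, 'v) trm set" where
  "down S t = {s \<in> CTerm_bot S. approx S s t}"

definition cones :: "('c, 'f) signature \<Rightarrow> ('c, 'f, 'v) trm set set" where
  "cones S = {K. K \<noteq> {} \<and> K \<subseteq> CTerm_bot S \<and> (\<forall>t\<in>K. \<forall>s\<in>CTerm_bot S. approx S s t \<longrightarrow> s \<in> K)}"


section \<open>Programs\<close>

text \<open>\<open>CRule f ts r C\<close> is the rule \<open>f(ts) \<rightarrow> r \<Leftarrow> C\<close>; a pair \<open>(a, b) \<in> C\<close> is the joinability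
  statement \<open>a \<bowtie> b\<close>.\<close>

datatype ('c, 'f, 'v) crule =
  CRule (defsym: 'f) (args: "('c, 'f, 'v) trm list") (rhs: "('c, 'f, 'v) trm")
    (conds: "(('c, 'f, 'v) trm \<times> ('c, 'f, 'v) trm) set")

definition is_rule :: "('c, 'f) signature \<Rightarrow> ('c, 'f, 'v) crule \<Rightarrow> bool" where
  "is_rule S \<rho> \<longleftrightarrow>
     defsym \<rho> \<in> FS S \<and>
     length (args \<rho>) = arF S (defsym \<rho>) \<and> set (args \<rho>) \<subseteq> CTerm S \<and> distinct (tuple_occs (args \<rho>)) \<and>
     rhs \<rho> \<in> Term_bot S \<and>
     finite (conds \<rho>) \<and> conds \<rho> \<subseteq> Term S \<times> Term S"

definition is_program :: "('c, 'f) signature \<Rightarrow> ('c, 'f, 'v) crule set \<Rightarrow> bool" where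
  "is_program S R \<longleftrightarrow> (\<forall>\<rho>\<in>R. is_rule S \<rho>)"

definition subst_rule :: "('v \<Rightarrow> ('c, 'f, 'v) trm) \<Rightarrow> ('c, 'f, 'v) crule \<Rightarrow> ('c, 'f, 'v) crule" where
  "subst_rule \<theta> \<rho> =
     CRule (defsym \<rho>) (map (subst \<theta>) (args \<rho>)) (subst \<theta> (rhs \<rho>))
       (map_prod (subst \<theta>) (subst \<theta>) ` conds \<rho>)"

definition instances :: "('c, 'f) signature \<Rightarrow> ('c, 'f, 'v) crule set \<Rightarrow> ('c, 'f, 'v) crule set" where
  "instances S R = {subst_rule \<theta> \<rho> | \<theta> \<rho>. \<theta> \<in> CSubst_bot S \<and> \<rho> \<in> R}"


section \<open>Provability\<close>

datatype ('c, 'f, 'v) formula =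
    Red "('c, 'f, 'v) trm" "('c, 'f, 'v) trm"
  | Join "('c, 'f, 'v) trm" "('c, 'f, 'v) trm"

inductive crwl :: "('c, 'f) signature \<Rightarrow> ('c, 'f, 'v) crule set \<Rightarrow> ('c, 'f, 'v) formula \<Rightarrow> bool"
  for S :: "('c, 'f) signature" and R :: "('c, 'f, 'v) crule set" where
  Bo: "e \<in> Term_bot S \<Longrightarrow> crwl S R (Red e Bot)"
| RR: "e \<in> range Var \<union> {Con c [] | c. c \<in> DS S \<and> arD S c = 0} \<Longrightarrow> crwl S R (Red e e)"
| DS: "c \<in> DS S \<Longrightarrow> length es = arD S c \<Longrightarrow> list_all2 (\<lambda>e t. crwl S R (Red e t)) es ts
    \<Longrightarrow> crwl S R (Red (Con c es) (Con c ts))"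
| OR: "CRule f ts r C \<in> instances S R \<Longrightarrow> t \<noteq> Bot
    \<Longrightarrow> list_all2 (\<lambda>e t. crwl S R (Red e t)) es ts
    \<Longrightarrow> (\<And>a b. (a, b) \<in> C \<Longrightarrow> crwl S R (Join a b))
    \<Longrightarrow> crwl S R (Red r t)
    \<Longrightarrow> crwl S R (Red (Fun f es) t)"
| Jo: "t \<in> CTerm S \<Longrightarrow> crwl S R (Red a t) \<Longrightarrow> crwl S R (Red b t) \<Longrightarrow> crwl S R (Join a b)"


section \<open>Term algebras\<close>

text \<open>Carrier and constructors are interpreted in the same way in all term algebras, so a term
  algebra is given by its interpretation of the function symbols. These are extensional functions,
  so that HOL equality is equality of term algebras (and, below, of operators on them).\<close>

type_synonym ('c, 'f, 'v) talg = "'f \<Rightarrow> ('c, 'f, 'v) trm list \<Rightarrow> ('c, 'f, 'v) trm set"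

definition TAlg :: "('c, 'f) signature \<Rightarrow> ('c, 'f, 'v) talg set" where
  "TAlg S = (\<Pi>\<^sub>E f\<in>FS S. {F \<in> tuples S (arF S f) \<rightarrow>\<^sub>E cones S.
     monotone_on (tuples S (arF S f)) (list_all2 (approx S)) (\<subseteq>) F})"

primrec eval :: "('c, 'f) signature \<Rightarrow> ('c, 'f, 'v) talg \<Rightarrow> ('v \<Rightarrow> ('c, 'f, 'v) trm)
    \<Rightarrow> ('c, 'f, 'v) trm \<Rightarrow> ('c, 'f, 'v) trm set" where
  "eval S A \<eta> Bot = down S Bot"
| "eval S A \<eta> (Var x) = down S (\<eta> x)"
| "eval S A \<eta> (Con c es) = \<Union>{down S (Con c us) | us. list_all2 (\<in>) us (map (eval S A \<eta>) es)}"
| "eval S A \<eta> (Fun f es) = \<Union>{A f us | us. list_all2 (\<in>) us (map (eval S A \<eta>) es)}"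

definition models :: "('c, 'f) signature \<Rightarrow> ('c, 'f, 'v) talg \<Rightarrow> ('v \<Rightarrow> ('c, 'f, 'v) trm)
    \<Rightarrow> (('c, 'f, 'v) trm \<times> ('c, 'f, 'v) trm) set \<Rightarrow> bool" where
  "models S A \<eta> C \<longleftrightarrow> (\<forall>(a, b)\<in>C. eval S A \<eta> a \<inter> eval S A \<eta> b \<inter> CTerm S \<noteq> {})"

text \<open>The identity valuation is \<open>Var\<close>.\<close>

definition T_op :: "('c, 'f) signature \<Rightarrow> ('c, 'f, 'v) crule set
    \<Rightarrow> ('c, 'f, 'v) talg \<Rightarrow> ('c, 'f, 'v) talg" where
  "T_op S R = (\<lambda>A\<in>TAlg S. \<lambda>f\<in>FS S. \<lambda>ts\<in>tuples S (arF S f).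
     {t. \<exists>ss r C. CRule f ss r C \<in> instances S R \<and> list_all2 (approx S) ss ts \<and>
           models S A Var C \<and> t \<in> eval S A Var r} \<union> {Bot})"

definition M_alg :: "('c, 'f) signature \<Rightarrow> ('c, 'f, 'v) crule set \<Rightarrow> ('c, 'f, 'v) talg" where
  "M_alg S R = (\<lambda>f\<in>FS S. \<lambda>ts\<in>tuples S (arF S f).
     {r \<in> CTerm_bot S. crwl S R (Red (Fun f ts) r)})"


section \<open>Modules\<close>

record ('c, 'f, 'v) prog_module =
  params :: "'f set"
  exports :: "'f set"
  rl :: "('c, 'f, 'v) crule set"

definition rule_fsyms :: "('c, 'f, 'v) crule \<Rightarrow> 'f set" where
  "rule_fsyms \<rho> = {defsym \<rho>} \<union> \<Union>(fsyms ` set (args \<rho>)) \<union> fsyms (rhs \<rho>)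
     \<union> (\<Union>(a, b)\<in>conds \<rho>. fsyms a \<union> fsyms b)"

definition module_of :: "('c, 'f, 'v) crule set \<Rightarrow> ('c, 'f, 'v) prog_module" where
  "module_of R = \<lparr>params = \<Union>(rule_fsyms ` R) - defsym ` R, exports = defsym ` R, rl = R\<rparr>"

definition Modules :: "('c, 'f) signature \<Rightarrow> ('c, 'f, 'v) prog_module set" where
  "Modules S = {module_of R | R. is_program S R \<and> (\<forall>\<rho>\<in>R. rhs \<rho> \<noteq> Bot)}"

definition mod_union :: "('c, 'f, 'v) prog_module \<Rightarrow> ('c, 'f, 'v) prog_module \<Rightarrow> ('c, 'f, 'v) prog_module" where
  "mod_union P Q = module_of (rl P \<union> rl Q)"

definition mod_delete :: "'f set \<Rightarrow> ('c, 'f, 'v) prog_module \<Rightarrow> ('c, 'f, 'v) prog_module" where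
  "mod_delete \<sigma> P = module_of {\<rho> \<in> rl P. defsym \<rho> \<notin> \<sigma>}"

text \<open>\<open>linearize \<nu> t (X, k, D)\<close> traverses \<open>t\<close> from left to right and replaces every occurrence of
  \<open>\<bottom>\<close> and every variable occurrence met before by the next fresh variable of the sequence \<open>\<nu>\<close>.
  The state consists of the variables \<open>X\<close> met so far, the number \<open>k\<close> of fresh variables used, and
  the joinability statements \<open>D\<close> between a repeated variable and its replacements.\<close>

fun linearize :: "(nat \<Rightarrow> 'v) \<Rightarrow> ('c, 'f, 'v) trm
    \<Rightarrow> 'v set \<times> nat \<times> (('c, 'f, 'v) trm \<times> ('c, 'f, 'v) trm) set
    \<Rightarrow> ('c, 'f, 'v) trm \<times> 'v set \<times> nat \<times> (('c, 'f, 'v) trm \<times> ('c, 'f, 'v) trm) set"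
  and linearize_list :: "(nat \<Rightarrow> 'v) \<Rightarrow> ('c, 'f, 'v) trm list
    \<Rightarrow> 'v set \<times> nat \<times> (('c, 'f, 'v) trm \<times> ('c, 'f, 'v) trm) set
    \<Rightarrow> ('c, 'f, 'v) trm list \<times> 'v set \<times> nat \<times> (('c, 'f, 'v) trm \<times> ('c, 'f, 'v) trm) set" where
  "linearize \<nu> Bot (X, k, D) = (Var (\<nu> k), X, Suc k, D)"
| "linearize \<nu> (Var x) (X, k, D) =
     (if x \<in> X then (Var (\<nu> k), X, Suc k, insert (Var x, Var (\<nu> k)) D)
      else (Var x, insert x X, k, D))"
| "linearize \<nu> (Con c ts) st = (let (ts', st') = linearize_list \<nu> ts st in (Con c ts', st'))"
| "linearize \<nu> (Fun f ts) st = (let (ts', st') = linearize_list \<nu> ts st in (Fun f ts', st'))"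
| "linearize_list \<nu> [] st = ([], st)"
| "linearize_list \<nu> (t # ts) st =
     (let (t', st') = linearize \<nu> t st; (ts', st'') = linearize_list \<nu> ts st' in (t' # ts', st''))"

text \<open>Since the set of variables is countably infinite, \<open>from_nat_into\<close> enumerates the variables
  occurring neither in \<open>ts\<close> nor in \<open>r\<close> without repetitions.\<close>

definition crr :: "'f \<Rightarrow> ('c, 'f, 'v) trm list \<Rightarrow> ('c, 'f, 'v) trm \<Rightarrow> ('c, 'f, 'v) crule" where
  "crr f ts r =
     (let \<nu> = from_nat_into (- (\<Union>(vars ` set ts) \<union> vars r));
          (ts', _, _, D) = linearize_list \<nu> ts ({}, 0, {})
      in CRule f ts' r
           (D \<union> {(Var x, Var x) | x. x \<in> vars r}
              \<union> {(Var x, Var x) | x. count_list (tuple_occs ts) x = 1}))"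

definition mod_closure :: "('c, 'f) signature \<Rightarrow> 'f set
    \<Rightarrow> ('c, 'f, 'v) prog_module \<Rightarrow> ('c, 'f, 'v) prog_module" where
  "mod_closure S \<sigma> P = module_of {crr f ts r | f ts r.
     f \<in> \<sigma> \<and> ts \<in> tuples S (arF S f) \<and> r \<in> CTerm_bot S \<and> r \<noteq> Bot \<and>
     crwl S (rl P) (Red (Fun f ts) r)}"

definition is_renaming :: "('c, 'f) signature \<Rightarrow> ('f \<Rightarrow> 'f) \<Rightarrow> bool" where
  "is_renaming S \<rho> \<longleftrightarrow> \<rho> \<in> FS S \<rightarrow> FS S \<and> (\<forall>f\<in>FS S. arF S (\<rho> f) = arF S f)"

definition rename_trm :: "('f \<Rightarrow> 'f) \<Rightarrow> ('c, 'f, 'v) trm \<Rightarrow> ('c, 'f, 'v) trm" where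
  "rename_trm \<rho> = map_trm id \<rho> id"

definition rename_rule :: "('f \<Rightarrow> 'f) \<Rightarrow> ('c, 'f, 'v) crule \<Rightarrow> ('c, 'f, 'v) crule" where
  "rename_rule \<rho> R =
     CRule (\<rho> (defsym R)) (map (rename_trm \<rho>) (args R)) (rename_trm \<rho> (rhs R))
       (map_prod (rename_trm \<rho>) (rename_trm \<rho>) ` conds R)"

definition mod_rename :: "('f \<Rightarrow> 'f) \<Rightarrow> ('c, 'f, 'v) prog_module \<Rightarrow> ('c, 'f, 'v) prog_module" where
  "mod_rename \<rho> P = module_of (rename_rule \<rho> ` rl P)"


section \<open>Semantics and observations\<close>

definition T_equiv :: "('c, 'f) signature \<Rightarrow> ('c, 'f, 'v) prog_module \<Rightarrow> ('c, 'f, 'v) prog_module \<Rightarrow> bool" where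
  "T_equiv S P Q \<longleftrightarrow> T_op S (rl P) = T_op S (rl Q)"

definition Ob :: "('c, 'f) signature \<Rightarrow> ('c, 'f, 'v) prog_module \<Rightarrow> ('c, 'f, 'v) talg" where
  "Ob S P = M_alg S (rl P)"

end

theory Submission
  imports Defs
begin

text \<open>The algebra \<open>\<M>\<^sub>\<R>\<close> is the least pre-fixpoint of \<open>\<T>\<^sub>\<R>\<close>, so the operator determines the
  observation. Closure depends on the program only through \<open>\<M>\<^sub>\<R>\<close>, hence \<open>\<T>\<close>-equivalent modules
  even have the same closure. The other operations act directly on operators: union is pointwise
  union, deletion overwrites the deleted symbols by \<open>{\<bottom>}\<close>, and renaming by \<open>\<rho>\<close> pulls the argument
  algebra back along \<open>\<rho>\<close> and takes unions over the (possibly non-singleton) fibres of \<open>\<rho>\<close>.\<close>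

section \<open>Terms, substitutions and the approximation order\<close>

lemma nth_in_superset [simp]: "set xs \<subseteq> A \<Longrightarrow> i < length xs \<Longrightarrow> xs ! i \<in> A"
  by (auto dest: nth_mem)

lemma CTerm_bot_simps [simp]:
  "Bot \<in> CTerm_bot S"
  "Var x \<in> CTerm_bot S"
  "Con c ts \<in> CTerm_bot S \<longleftrightarrow> c \<in> DS S \<and> length ts = arD S c \<and> set ts \<subseteq> CTerm_bot S"
  "Fun f ts \<notin> CTerm_bot S"
  by (auto simp: CTerm_bot_def intro: Term_bot.intros elim: Term_bot.cases)

lemma Term_bot_simps [simp]:
  "Bot \<in> Term_bot S"
  "Var x \<in> Term_bot S"
  "Con c ts \<in> Term_bot S \<longleftrightarrow> c \<in> DS S \<and> length ts = arD S c \<and> set ts \<subseteq> Term_bot S"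
  "Fun f ts \<in> Term_bot S \<longleftrightarrow> f \<in> FS S \<and> length ts = arF S f \<and> set ts \<subseteq> Term_bot S"
  by (auto intro: Term_bot.intros elim: Term_bot.cases)

lemma CTerm_bot_imp_Term_bot: "t \<in> CTerm_bot S \<Longrightarrow> t \<in> Term_bot S"
  by (simp add: CTerm_bot_def)

lemma Var_CSubst_bot: "Var \<in> CSubst_bot S"
  by (simp add: CSubst_bot_def)

lemma subst_CTerm_bot:
  assumes "\<theta> \<in> CSubst_bot S" "t \<in> CTerm_bot S"
  shows "subst \<theta> t \<in> CTerm_bot S"
  using assms(2)
proof (induction t rule: trm.induct)
  case (Var x)
  then show ?case using assms(1) by (auto simp: CSubst_bot_def)
qed auto

lemma subst_Term_bot:
  assumes "\<theta> \<in> CSubst_bot S" "t \<in> Term_bot S"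
  shows "subst \<theta> t \<in> Term_bot S"
  using assms(2)
proof (induction t rule: trm.induct)
  case (Var x)
  then show ?case using assms(1) by (auto simp: CSubst_bot_def intro: CTerm_bot_imp_Term_bot)
qed auto

lemma approx_CTerm_bot: "approx S s t \<Longrightarrow> s \<in> CTerm_bot S \<and> t \<in> CTerm_bot S"
proof (induction rule: approx.induct)
  case (approx_Con c ss ts)
  then show ?case by (fastforce simp: list_all2_conv_all_nth in_set_conv_nth)
qed auto

lemma approx_Bot_iff [simp]: "approx S s Bot \<longleftrightarrow> s = Bot"
  using approx_inv[of S s Bot] by (cases s) (auto intro: approx.approx_Bot)

lemma approx_Var_iff: "approx S s (Var x) \<longleftrightarrow> s = Bot \<or> s = Var x"
  using approx_inv[of S s "Var x"] by (cases s) (auto intro: approx.approx_Bot approx.approx_refl)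

lemma approx_ConD:
  assumes "approx S s (Con c ts)"
  shows "s = Bot \<or> (\<exists>ss. s = Con c ss \<and> list_all2 (approx S) ss ts)"
  using approx_inv[OF assms] by (cases s) auto

lemma tuples_approx_refl: "ts \<in> tuples S n \<Longrightarrow> list_all2 (approx S) ts ts"
  by (auto simp: tuples_def list_all2_same intro: approx.approx_refl)

text \<open>Both sides of \<open>approx\<close> lie in \<open>CTerm_bot S\<close>, so only the
  length has to be supplied.\<close>

lemma list_all2_approx_tuples:
  "list_all2 (approx S) ss ts \<Longrightarrow> length ts = n \<Longrightarrow> ss \<in> tuples S n \<and> ts \<in> tuples S n"
  unfolding tuples_def list_all2_conv_all_nth
  by (auto simp: in_set_conv_nth) (blast dest: approx_CTerm_bot)+

section \<open>Cones, term algebras and evaluation\<close>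

lemma conesD:
  assumes "K \<in> cones S"
  shows "K \<subseteq> CTerm_bot S" "Bot \<in> K" "t \<in> K \<Longrightarrow> approx S s t \<Longrightarrow> s \<in> K"
proof -
  show "K \<subseteq> CTerm_bot S" "t \<in> K \<Longrightarrow> approx S s t \<Longrightarrow> s \<in> K"
    using assms by (auto simp: cones_def dest: approx_CTerm_bot)
  then show "Bot \<in> K"
    using assms by (fastforce simp: cones_def intro: approx.approx_Bot)
qed

lemma down_cone: "t \<in> CTerm_bot S \<Longrightarrow> down S t \<in> cones S"
  by (auto simp: cones_def down_def intro: approx.approx_refl approx.approx_trans)

lemma Union_cones:
  assumes "\<K> \<noteq> {}" "\<K> \<subseteq> cones S"
  shows "\<Union>\<K> \<in> cones S"
  using assms unfolding cones_def by blast

lemma TAlg_cone: "A \<in> TAlg S \<Longrightarrow> f \<in> FS S \<Longrightarrow> ts \<in> tuples S (arF S f) \<Longrightarrow> A f ts \<in> cones S"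
  by (fastforce simp: TAlg_def PiE_def Pi_def)

lemma TAlg_mono:
  assumes "A \<in> TAlg S" "f \<in> FS S" "list_all2 (approx S) ss ts" "length ts = arF S f"
  shows "A f ss \<subseteq> A f ts"
proof -
  have "monotone_on (tuples S (arF S f)) (list_all2 (approx S)) (\<subseteq>) (A f)"
    using assms(1,2) by (auto simp: TAlg_def PiE_def Pi_def)
  then show ?thesis
    using list_all2_approx_tuples[OF assms(3,4)] assms(3) by (auto dest: monotone_onD)
qed

lemma list_all2_mem_tuples:
  assumes "list_all2 (\<in>) us Ks" "\<And>K. K \<in> set Ks \<Longrightarrow> K \<subseteq> CTerm_bot S"
  shows "us \<in> tuples S (length Ks)"
  using assms unfolding tuples_def list_all2_conv_all_nth
  by (fastforce simp: in_set_conv_nth)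

text \<open>On compound terms evaluation is a union of cones indexed by choices of argument values.
  The argument cones consist of constructor terms, so every choice is a tuple on which the
  interpretation yields a cone.\<close>

lemma eval_cone:
  assumes "A \<in> TAlg S" "\<eta> \<in> CSubst_bot S" "e \<in> Term_bot S"
  shows "eval S A \<eta> e \<in> cones S"
  using assms(3)
proof (induction e rule: trm.induct)
  case Bot
  show ?case by (simp add: down_cone)
next
  case (Var x)
  then show ?case using assms(2) by (auto simp: CSubst_bot_def intro!: down_cone)
next
  case (Con c es)
  let ?Ks = "map (eval S A \<eta>) es"
  have cones: "K \<in> cones S" if "K \<in> set ?Ks" for K
    using that Con by auto
  \<comment> \<open>Every cone contains \<open>Bot\<close>, so the tuple of \<open>Bot\<close>s is
    an admissible choice and the union is not over an empty family.\<close>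
  then have "list_all2 (\<in>) (replicate (length es) Bot) ?Ks"
    by (auto simp: list_all2_conv_all_nth intro!: conesD(2)[of _ S])
  moreover have "down S (Con c us) \<in> cones S" if "list_all2 (\<in>) us ?Ks" for us
  proof -
    have "us \<in> tuples S (length ?Ks)"
      using that cones by (intro list_all2_mem_tuples conesD(1))
    then show ?thesis
      using Con.prems by (intro down_cone) (simp add: tuples_def)
  qed
  ultimately show ?case
    unfolding eval.simps by (intro Union_cones) auto
next
  case (Fun f es)
  let ?Ks = "map (eval S A \<eta>) es"
  have cones: "K \<in> cones S" if "K \<in> set ?Ks" for K
    using that Fun by auto
  then have "list_all2 (\<in>) (replicate (length es) Bot) ?Ks"
    by (auto simp: list_all2_conv_all_nth intro!: conesD(2)[of _ S])
  moreover have "A f us \<in> cones S" if "list_all2 (\<in>) us ?Ks" for us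
  proof -
    have "us \<in> tuples S (length ?Ks)"
      using that cones by (intro list_all2_mem_tuples conesD(1))
    then show ?thesis
      using Fun.prems by (intro TAlg_cone[OF assms(1)]) simp_all
  qed
  ultimately show ?case
    unfolding eval.simps by (intro Union_cones) auto
qed

text \<open>Without function symbols the algebra \<open>A\<close> has no influence. Argument values
  approximate the arguments, and the arguments themselves are among the values, so the union
  collapses to its largest member.\<close>

lemma eval_CTerm_bot:
  assumes "t \<in> CTerm_bot S"
  shows "eval S A Var t = down S t"
  using assms
proof (induction t rule: trm.induct)
  case (Con c ts)
  have IH: "eval S A Var t = down S t" if "t \<in> set ts" for t
    using Con that by auto
  show ?case
  proof (intro equalityI subsetI)
    fix s assume "s \<in> eval S A Var (Con c ts)"
    then obtain us where us: "s \<in> down S (Con c us)"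
      "list_all2 (\<in>) us (map (eval S A Var) ts)" by auto
    then have "list_all2 (approx S) us ts"
      using IH by (auto simp: list_all2_conv_all_nth down_def)
    then have "approx S (Con c us) (Con c ts)"
      using Con.prems by (auto intro!: approx.approx_Con dest: list_all2_lengthD)
    then show "s \<in> down S (Con c ts)"
      using us(1) by (auto simp: down_def intro: approx.approx_trans)
  next
    fix s assume "s \<in> down S (Con c ts)"
    moreover have "list_all2 (\<in>) ts (map (eval S A Var) ts)"
      using IH Con.prems by (simp add: list_all2_conv_all_nth down_def approx.approx_refl)
    ultimately show "s \<in> eval S A Var (Con c ts)" by auto
  qed
qed auto

text \<open>The substituted values may contain \<open>Bot\<close>, so \<open>Term S\<close> and
  \<open>CTerm S\<close> in the rule format weaken to \<open>Term_bot S\<close> and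
  \<open>CTerm_bot S\<close> for instances.\<close>

lemma instancesD:
  assumes "is_program S R" "CRule f ss r C \<in> instances S R"
  shows "f \<in> FS S" "ss \<in> tuples S (arF S f)" "r \<in> Term_bot S" "C \<subseteq> Term_bot S \<times> Term_bot S"
proof -
  obtain \<theta> \<rho> where \<theta>: "\<theta> \<in> CSubst_bot S" "\<rho> \<in> R" "CRule f ss r C = subst_rule \<theta> \<rho>"
    using assms(2) by (auto simp: instances_def)
  moreover have "is_rule S \<rho>"
    using assms(1) \<theta>(2) by (simp add: is_program_def)
  ultimately show "f \<in> FS S" "ss \<in> tuples S (arF S f)" "r \<in> Term_bot S"
      "C \<subseteq> Term_bot S \<times> Term_bot S"
    by (auto simp: subst_rule_def is_rule_def tuples_def CTerm_def Term_def
        intro!: subst_CTerm_bot subst_Term_bot)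
qed


section \<open>The term model as least pre-fixpoint\<close>

lemma crwl_RedD:
  assumes "is_program S R" "crwl S R (Red e t)"
  shows "e \<in> Term_bot S" "t \<in> CTerm_bot S"
proof -
  \<comment> \<open>Both kinds of formulas share one inductive predicate, so the claim must range
    over all formulas; it is trivial on joinability statements.\<close>
  have "case \<phi> of Red e t \<Rightarrow> e \<in> Term_bot S \<and> t \<in> CTerm_bot S | Join a b \<Rightarrow> True"
    if "crwl S R \<phi>" for \<phi>
    using that
  proof (induction rule: crwl.induct)
    case (DS c es ts)
    then show ?case by (fastforce simp: list_all2_conv_all_nth in_set_conv_nth)
  next
    case (OR f ts r C t es)
    have "length es = arF S f"
      using instancesD(2)[OF assms(1) OR.hyps(1)] OR.IH(1)
      by (auto simp: tuples_def dest: list_all2_lengthD)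
    moreover have "set es \<subseteq> Term_bot S"
      using OR.IH(1) by (fastforce simp: list_all2_conv_all_nth in_set_conv_nth)
    ultimately show ?case
      using OR.IH instancesD(1)[OF assms(1) OR.hyps(1)] by simp
  qed auto
  from this[OF assms(2)] show "e \<in> Term_bot S" "t \<in> CTerm_bot S" by auto
qed

text \<open>The last inference is kept and its target lowered: (DS) lowers the components, (OR)
  lowers only the premise for the right-hand side. The target \<open>Bot\<close> goes through (Bo),
  because (OR) excludes it.\<close>

lemma crwl_down:
  assumes "is_program S R" "crwl S R (Red e t)" "approx S s t"
  shows "crwl S R (Red e s)"
proof -
  have "case \<phi> of Red e t \<Rightarrow> \<forall>s. approx S s t \<longrightarrow> crwl S R (Red e s) | Join a b \<Rightarrow> True"
    if "crwl S R \<phi>" for \<phi>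
    using that
  proof (induction rule: crwl.induct)
    case (Bo e)
    then show ?case by (auto intro: crwl.Bo)
  next
    case (RR e)
    moreover have "crwl S R (Red e Bot)"
      using RR by (auto intro!: crwl.Bo)
    moreover have "crwl S R (Red e e)"
      using RR by (rule crwl.RR)
    ultimately show ?case
      by (auto simp: approx_Var_iff dest!: approx_ConD)
  next
    case (DS c es ts)
    \<comment> \<open>The derivation is rebuilt to learn from \<open>crwl_RedD\<close> that
      \<open>Con c es\<close> is a term, as (Bo) demands.\<close>
    have "crwl S R (Red (Con c es) (Con c ts))"
      using DS by (intro crwl.DS) (auto elim: list_all2_mono)
    then have "crwl S R (Red (Con c es) Bot)"
      by (intro crwl.Bo crwl_RedD(1)[OF assms(1)])
    moreover have "crwl S R (Red (Con c es) (Con c ss))" if "list_all2 (approx S) ss ts" for ss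
      using DS that by (intro crwl.DS) (auto simp: list_all2_conv_all_nth)
    ultimately show ?case by (auto dest!: approx_ConD)
  next
    case (OR f ts r C t es)
    have es: "list_all2 (\<lambda>e t. crwl S R (Red e t)) es ts"
      using OR.IH(1) by (auto elim: list_all2_mono)
    then have "crwl S R (Red (Fun f es) t)"
      using OR by (intro crwl.OR[of f ts r C]) auto
    then have "crwl S R (Red (Fun f es) Bot)"
      by (intro crwl.Bo crwl_RedD(1)[OF assms(1)])
    moreover have "crwl S R (Red (Fun f es) s)" if "approx S s t" "s \<noteq> Bot" for s
      using OR es that by (intro crwl.OR[of f ts r C]) auto
    ultimately show ?case by auto
  qed auto
  from this[OF assms(2)] assms(3) show ?thesis by simp
qed

text \<open>An application of (RR) to a constant is covered by the second alternative with
  \<open>ts = []\<close>.\<close>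

lemma crwl_Con_cases:
  assumes "crwl S R (Red (Con c es) t)"
  shows "t = Bot \<or> (\<exists>ts. t = Con c ts \<and> list_all2 (\<lambda>e t. crwl S R (Red e t)) es ts)"
  using assms by cases auto

text \<open>(OR) cannot fire on a constructor term, so a derivation can only cut subterms down to
  \<open>Bot\<close>; conversely the derivation of \<open>u\<close> from itself is lowered by
  \<open>crwl_down\<close>. This translates between the order conditions of \<open>T_op\<close> and
  the argument premises of (OR).\<close>

lemma crwl_CTerm_bot_iff:
  assumes "is_program S R" "u \<in> CTerm_bot S"
  shows "crwl S R (Red u s) \<longleftrightarrow> approx S s u"
proof
  show "crwl S R (Red u s) \<Longrightarrow> approx S s u"
    using assms(2)
  proof (induction u arbitrary: s rule: trm.induct)
    case (Con c us)
    from crwl_Con_cases[OF Con.prems(1)] show ?case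
    proof (elim disjE exE conjE)
      fix ss assume s: "s = Con c ss" "list_all2 (\<lambda>e t. crwl S R (Red e t)) us ss"
      then have "list_all2 (approx S) ss us"
        using Con.IH Con.prems(2) by (simp add: list_all2_conv_all_nth)
      then show ?thesis
        using s Con.prems by (auto intro!: approx.approx_Con dest: list_all2_lengthD)
    qed (use Con.prems in \<open>auto intro: approx.approx_Bot\<close>)
  next
    case (Var x)
    from Var.prems(1) show ?case
      by cases (auto simp: approx_Var_iff)
  qed (auto elim: crwl.cases)
next
  have "crwl S R (Red u u)"
    using assms(2)
  proof (induction u)
    case (Con c us)
    then show ?case by (intro crwl.DS) (auto simp: list_all2_same)
  qed (auto intro: crwl.intros)
  then show "approx S s u \<Longrightarrow> crwl S R (Red u s)"
    by (rule crwl_down[OF assms(1)])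
qed

text \<open>A cut rule for arguments. It supplies both the monotonicity of the term model and the
  function case of evaluation in it.\<close>

lemma crwl_Fun_trans:
  assumes "is_program S R" "crwl S R (Red (Fun f us) t)" "set us \<subseteq> CTerm_bot S"
    and "list_all2 (\<lambda>e u. crwl S R (Red e u)) es us"
  shows "crwl S R (Red (Fun f es) t)"
  using assms(2)
proof cases
  case Bo
  moreover have "set es \<subseteq> Term_bot S"
    using assms(4) unfolding list_all2_conv_all_nth
    by (metis crwl_RedD(1)[OF assms(1)] in_set_conv_nth subsetI)
  ultimately show ?thesis
    using assms(4) by (auto intro!: crwl.Bo dest: list_all2_lengthD)
next
  case (OR ts r C)
  \<comment> \<open>The entries of \<open>us\<close> are constructor terms, so those of
    \<open>ts\<close> lie below them; lowering the reductions from \<open>es\<close> to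
    \<open>us\<close> reaches \<open>ts\<close>.\<close>
  have "list_all2 (\<lambda>e t. crwl S R (Red e t)) es ts"
    using OR(3) assms(3,4) crwl_down[OF assms(1)] crwl_CTerm_bot_iff[OF assms(1)]
    by (fastforce simp: list_all2_conv_all_nth)
  with OR show ?thesis by (intro crwl.OR[of f ts r C]) auto
qed auto

section \<open>The term model as a term algebra\<close>

lemma M_alg_apply:
  assumes "f \<in> FS S" "ts \<in> tuples S (arF S f)"
  shows "M_alg S R f ts = {r \<in> CTerm_bot S. crwl S R (Red (Fun f ts) r)}"
  using assms by (simp add: M_alg_def)

lemma tuples_Fun_Term_bot:
  "f \<in> FS S \<Longrightarrow> ts \<in> tuples S (arF S f) \<Longrightarrow> Fun f ts \<in> Term_bot S"
  by (auto simp: tuples_def CTerm_bot_imp_Term_bot)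

lemma M_alg_TAlg:
  assumes "is_program S R"
  shows "M_alg S R \<in> TAlg S"
proof -
  have "M_alg S R f ts \<in> cones S" if "f \<in> FS S" "ts \<in> tuples S (arF S f)" for f ts
  proof -
    have "Bot \<in> M_alg S R f ts"
      using that tuples_Fun_Term_bot[OF that] by (simp add: M_alg_apply crwl.Bo)
    then show ?thesis
      using that crwl_down[OF assms] unfolding cones_def
      by (intro CollectI conjI) (blast, auto simp: M_alg_apply)
  qed
  moreover have "M_alg S R f ss \<subseteq> M_alg S R f ts"
    if "f \<in> FS S" "ss \<in> tuples S (arF S f)" "ts \<in> tuples S (arF S f)" "list_all2 (approx S) ss ts"
    for f ss ts
  proof -
    \<comment> \<open>The direction flips: larger arguments reduce to smaller ones, so whatever
      \<open>ss\<close> yields can be derived from \<open>ts\<close> by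
      \<open>crwl_Fun_trans\<close>.\<close>
    have "list_all2 (\<lambda>e u. crwl S R (Red e u)) ts ss"
      using that crwl_CTerm_bot_iff[OF assms] by (simp add: tuples_def list_all2_conv_all_nth)
    then show ?thesis
      using that crwl_Fun_trans[OF assms] by (auto simp: M_alg_apply tuples_def)
  qed
  ultimately show ?thesis
    by (auto simp: TAlg_def M_alg_def PiE_def Pi_def monotone_on_def)
qed

text \<open>Completeness of the calculus for the term model. A value arises from values of the
  arguments, which are derivable by induction; (DS) followed by \<open>crwl_down\<close>, or
  \<open>crwl_Fun_trans\<close>, composes these derivations.\<close>

lemma eval_M_alg_imp_crwl:
  assumes "is_program S R" "e \<in> Term_bot S" "t \<in> eval S (M_alg S R) Var e"
  shows "crwl S R (Red e t)"
  using assms(2,3)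
proof (induction e arbitrary: t rule: trm.induct)
  case (Con c es)
  let ?Ks = "map (eval S (M_alg S R) Var) es"
  obtain us where us: "t \<in> down S (Con c us)" "list_all2 (\<in>) us ?Ks"
    using Con.prems by auto
  then have "list_all2 (\<lambda>e u. crwl S R (Red e u)) es us"
    using Con.IH Con.prems(1) by (auto simp: list_all2_conv_all_nth)
  then have "crwl S R (Red (Con c es) (Con c us))"
    using Con.prems by (intro crwl.DS) auto
  then show ?case
    using us(1) crwl_down[OF assms(1)] by (auto simp: down_def)
next
  case (Fun f es)
  let ?Ks = "map (eval S (M_alg S R) Var) es"
  obtain us where us: "t \<in> M_alg S R f us" "list_all2 (\<in>) us ?Ks"
    using Fun.prems by auto
  \<comment> \<open>\<open>M_alg S R f\<close> describes derivability only on \<open>tuples\<close>;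
    evaluations are cones, hence sets of constructor terms, which places \<open>us\<close>
    there.\<close>
  have "us \<in> tuples S (arF S f)"
    using list_all2_mem_tuples[OF us(2), of S] Fun.prems
      eval_cone[OF M_alg_TAlg[OF assms(1)] Var_CSubst_bot]
    by (auto dest: conesD(1))
  moreover have "list_all2 (\<lambda>e u. crwl S R (Red e u)) es us"
    using Fun.IH Fun.prems(1) us(2) by (auto simp: list_all2_conv_all_nth)
  ultimately show ?case
    using us(1) Fun.prems crwl_Fun_trans[OF assms(1)] by (auto simp: M_alg_apply tuples_def)
qed (use assms(1) in \<open>auto simp: down_def crwl_CTerm_bot_iff\<close>)

section \<open>The operator and its pre-fixpoints\<close>

lemma T_op_apply:
  assumes "A \<in> TAlg S" "f \<in> FS S" "ts \<in> tuples S (arF S f)"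
  shows "T_op S R A f ts = {t. \<exists>ss r C. CRule f ss r C \<in> instances S R \<and>
    list_all2 (approx S) ss ts \<and> models S A Var C \<and> t \<in> eval S A Var r} \<union> {Bot}"
  using assms by (simp add: T_op_def)

text \<open>The restrictions in \<open>T_op\<close> make any two such operators agree off these
  domains.\<close>

lemma T_op_eqI:
  assumes "\<And>A f ts. A \<in> TAlg S \<Longrightarrow> f \<in> FS S \<Longrightarrow> ts \<in> tuples S (arF S f)
    \<Longrightarrow> T_op S R A f ts = T_op S R' A f ts"
  shows "T_op S R = T_op S R'"
proof (rule ext)+
  fix A f ts
  show "T_op S R A f ts = T_op S R' A f ts"
    using assms[of A f ts]
    by (cases "A \<in> TAlg S \<and> f \<in> FS S \<and> ts \<in> tuples S (arF S f)") (auto simp: T_op_def)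
qed

text \<open>Each contribution to \<open>T_op\<close> is an instance of (OR): conditions become
  premises by (Jo), and completeness derives the value of the right-hand side.\<close>

lemma T_op_M_alg_subset:
  assumes "is_program S R" "f \<in> FS S" "ts \<in> tuples S (arF S f)"
  shows "T_op S R (M_alg S R) f ts \<subseteq> M_alg S R f ts"
proof
  let ?M = "M_alg S R"
  note cone = conesD(1)[OF eval_cone[OF M_alg_TAlg[OF assms(1)] Var_CSubst_bot]]
  fix t assume t: "t \<in> T_op S R ?M f ts"
  show "t \<in> ?M f ts"
  proof (cases "t = Bot")
    case True
    then show ?thesis
      using assms(2,3) tuples_Fun_Term_bot[OF assms(2,3)] by (simp add: M_alg_apply crwl.Bo)
  next
    case False
    then obtain ss r C where inst: "CRule f ss r C \<in> instances S R"
      and ss: "list_all2 (approx S) ss ts" and C: "models S ?M Var C" and r: "t \<in> eval S ?M Var r"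
      using t by (auto simp: T_op_apply[OF M_alg_TAlg[OF assms(1)] assms(2,3)])
    note D = instancesD[OF assms(1) inst]
    have "list_all2 (\<lambda>e t. crwl S R (Red e t)) ts ss"
      using ss assms(3) crwl_CTerm_bot_iff[OF assms(1)]
      by (simp add: tuples_def list_all2_conv_all_nth)
    moreover have "crwl S R (Join a b)" if "(a, b) \<in> C" for a b
    proof -
      have "eval S ?M Var a \<inter> eval S ?M Var b \<inter> CTerm S \<noteq> {}"
        using bspec[OF C[unfolded models_def] that] by simp
      then obtain u where "u \<in> CTerm S" "u \<in> eval S ?M Var a" "u \<in> eval S ?M Var b"
        by blast
      moreover have "a \<in> Term_bot S" "b \<in> Term_bot S"
        using that D(4) by auto
      ultimately show ?thesis
        by (intro crwl.Jo[of u] eval_M_alg_imp_crwl[OF assms(1)])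
    qed
    ultimately have "crwl S R (Red (Fun f ts) t)"
      using inst False eval_M_alg_imp_crwl[OF assms(1) D(3) r] by (intro crwl.OR)
    then show ?thesis
      using cone[OF D(3)] r assms(2,3) by (auto simp: M_alg_apply)
  qed
qed

text \<open>Soundness for an arbitrary pre-fixpoint \<open>A\<close>, by induction on derivations;
  \<open>pre\<close> is what validates (OR).\<close>

lemma crwl_sound:
  assumes "is_program S R" "A \<in> TAlg S"
    and pre: "\<And>f ts. f \<in> FS S \<Longrightarrow> ts \<in> tuples S (arF S f) \<Longrightarrow> T_op S R A f ts \<subseteq> A f ts"
  shows "crwl S R \<phi> \<Longrightarrow> (case \<phi> of Red e t \<Rightarrow> t \<in> eval S A Var e
    | Join a b \<Rightarrow> eval S A Var a \<inter> eval S A Var b \<inter> CTerm S \<noteq> {})"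
proof (induction rule: crwl.induct)
  case (Bo e)
  then show ?case using conesD(2)[OF eval_cone[OF assms(2) Var_CSubst_bot]] by simp
next
  case (RR e)
  then have "e \<in> CTerm_bot S" by auto
  then show ?case by (simp add: eval_CTerm_bot down_def approx.approx_refl)
next
  case (DS c es ts)
  have "crwl S R (Red (Con c es) (Con c ts))"
    using DS by (intro crwl.DS) (auto elim: list_all2_mono)
  then have "Con c ts \<in> down S (Con c ts)"
    using crwl_RedD(2)[OF assms(1)] unfolding down_def by (blast intro: approx.approx_refl)
  moreover have "list_all2 (\<in>) ts (map (eval S A Var) es)"
    using DS.IH by (auto simp: list_all2_conv_all_nth)
  ultimately show ?case by auto
next
  case (OR f ts r C t es)
  note D = instancesD[OF assms(1) OR.hyps(1)]
  have "models S A Var C"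
    using OR.IH(2) by (auto simp: models_def)
  \<comment> \<open>The operator is taken at the arguments \<open>ts\<close> of the rule instance
    itself, so its order condition is reflexivity.\<close>
  then have "t \<in> T_op S R A f ts"
    using OR.hyps(1) OR.IH(3) tuples_approx_refl[OF D(2)]
    by (auto simp: T_op_apply[OF assms(2) D(1,2)])
  then have "t \<in> A f ts"
    using pre[OF D(1,2)] by auto
  moreover have "list_all2 (\<in>) ts (map (eval S A Var) es)"
    using OR.IH(1) by (auto simp: list_all2_conv_all_nth)
  ultimately show ?case by auto
qed auto

text \<open>Soundness places \<open>t\<close> in the evaluation of \<open>Fun f ts\<close>, that is,
  in \<open>A f us\<close> for some \<open>us\<close> below \<open>ts\<close>; monotonicity of
  \<open>A f\<close> moves it to \<open>ts\<close>.\<close>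

lemma M_alg_least:
  assumes "is_program S R" "A \<in> TAlg S"
    and "\<And>f ts. f \<in> FS S \<Longrightarrow> ts \<in> tuples S (arF S f) \<Longrightarrow> T_op S R A f ts \<subseteq> A f ts"
    and f: "f \<in> FS S" and ts: "ts \<in> tuples S (arF S f)"
  shows "M_alg S R f ts \<subseteq> A f ts"
proof
  fix t assume "t \<in> M_alg S R f ts"
  then have "t \<in> eval S A Var (Fun f ts)"
    using crwl_sound[OF assms(1-3)] f ts by (fastforce simp: M_alg_apply)
  then obtain us where us: "t \<in> A f us" "list_all2 (\<in>) us (map (eval S A Var) ts)" by auto
  then have "list_all2 (approx S) us ts"
    using ts unfolding list_all2_map2
    by (elim list.rel_mono_strong) (auto simp: tuples_def eval_CTerm_bot down_def)
  then show "t \<in> A f ts"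
    using TAlg_mono[OF assms(2) f] us(1) ts by (auto simp: tuples_def)
qed

text \<open>Each term model is a pre-fixpoint of the common operator, so leastness of the other one
  gives both inclusions.\<close>

lemma M_alg_cong:
  assumes "is_program S R" "is_program S R'" "T_op S R = T_op S R'"
  shows "M_alg S R = M_alg S R'"
proof (rule ext)+
  fix f ts
  show "M_alg S R f ts = M_alg S R' f ts"
  proof (cases "f \<in> FS S \<and> ts \<in> tuples S (arF S f)")
    case True
    have "M_alg S R f ts \<subseteq> M_alg S R' f ts"
      using True T_op_M_alg_subset[OF assms(2)]
      by (intro M_alg_least assms M_alg_TAlg) (auto simp: assms(3))
    moreover have "M_alg S R' f ts \<subseteq> M_alg S R f ts"
      using True T_op_M_alg_subset[OF assms(1)]
      by (intro M_alg_least assms M_alg_TAlg) (auto simp: assms(3)[symmetric])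
    ultimately show ?thesis by (rule equalityI)
  qed (auto simp: M_alg_def)
qed


section \<open>Operations on modules\<close>

lemma rl_module_of [simp]: "rl (module_of R) = R"
  by (simp add: module_of_def)

lemma Modules_program: "P \<in> Modules S \<Longrightarrow> is_program S (rl P)"
  by (auto simp: Modules_def)

lemma T_op_Un:
  assumes "A \<in> TAlg S" "f \<in> FS S" "ts \<in> tuples S (arF S f)"
  shows "T_op S (R \<union> R') A f ts = T_op S R A f ts \<union> T_op S R' A f ts"
  using assms unfolding T_op_apply[OF assms] instances_def by blast

text \<open>Substitution leaves the defined symbol of a rule unchanged, so deletion commutes with
  taking instances.\<close>

lemma T_op_delete:
  assumes "A \<in> TAlg S" "f \<in> FS S" "ts \<in> tuples S (arF S f)"
  shows "T_op S {\<rho> \<in> R. defsym \<rho> \<notin> \<sigma>} A f ts = (if f \<in> \<sigma> then {Bot} else T_op S R A f ts)"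
proof -
  have "CRule f ss r C \<in> instances S {\<rho> \<in> R. defsym \<rho> \<notin> \<sigma>} \<longleftrightarrow>
      f \<notin> \<sigma> \<and> CRule f ss r C \<in> instances S R" for ss r C
    by (auto simp: instances_def subst_rule_def)
  then show ?thesis
    unfolding T_op_apply[OF assms] by auto
qed

text \<open>The rules of both closures are images under \<open>crr\<close> of the same triples.
  Since \<sigma> lies in \<open>FS S\<close>, derivability for these triples can be read off
  \<open>M_alg\<close>.\<close>

lemma mod_closure_cong:
  assumes "M_alg S (rl P) = M_alg S (rl Q)" "\<sigma> \<subseteq> FS S"
  shows "mod_closure S \<sigma> P = mod_closure S \<sigma> Q"
proof -
  have "crwl S (rl P) (Red (Fun f ts) r) \<longleftrightarrow> crwl S (rl Q) (Red (Fun f ts) r)"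
    if "f \<in> \<sigma>" "ts \<in> tuples S (arF S f)" "r \<in> CTerm_bot S" for f ts r
    using that assms(2) M_alg_apply[of f S ts "rl P"] M_alg_apply[of f S ts "rl Q"]
    by (auto simp: assms(1))
  then show ?thesis
    unfolding mod_closure_def by (intro arg_cong[where f = module_of]) blast
qed

section \<open>Renaming of function symbols\<close>

lemma rename_trm_simps [simp]:
  "rename_trm \<rho> Bot = Bot"
  "rename_trm \<rho> (Var x) = Var x"
  "rename_trm \<rho> (Con c ts) = Con c (map (rename_trm \<rho>) ts)"
  "rename_trm \<rho> (Fun f ts) = Fun (\<rho> f) (map (rename_trm \<rho>) ts)"
  by (simp_all add: rename_trm_def)

lemma rename_trm_CTerm_bot: "t \<in> CTerm_bot S \<Longrightarrow> rename_trm \<rho> t = t"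
  by (induction t) (auto intro: map_idI)

text \<open>The values of \<theta> contain no function symbols, so renaming leaves them
  fixed.\<close>

lemma subst_rename_trm:
  assumes "\<theta> \<in> CSubst_bot S"
  shows "subst \<theta> (rename_trm \<rho> t) = rename_trm \<rho> (subst \<theta> t)"
proof (induction t)
  case (Var x)
  have "\<theta> x \<in> CTerm_bot S"
    using assms by (auto simp: CSubst_bot_def)
  then show ?case by (simp add: rename_trm_CTerm_bot)
qed auto

lemma subst_rule_rename_rule:
  assumes "\<theta> \<in> CSubst_bot S"
  shows "subst_rule \<theta> (rename_rule \<rho> R) = rename_rule \<rho> (subst_rule \<theta> R)"
  using subst_rename_trm[OF assms]
  by (auto simp: subst_rule_def rename_rule_def image_image map_prod_def case_prod_beta)

lemma instances_rename: "instances S (rename_rule \<rho> ` R) = rename_rule \<rho> ` instances S R"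
proof -
  have "instances S (rename_rule \<rho> ` R) =
      {subst_rule \<theta> (rename_rule \<rho> p) | \<theta> p. \<theta> \<in> CSubst_bot S \<and> p \<in> R}"
    unfolding instances_def by blast
  also have "\<dots> = {rename_rule \<rho> (subst_rule \<theta> p) | \<theta> p. \<theta> \<in> CSubst_bot S \<and> p \<in> R}"
    by (metis (no_types, opaque_lifting) subst_rule_rename_rule)
  also have "\<dots> = rename_rule \<rho> ` instances S R"
    unfolding instances_def by blast
  finally show ?thesis .
qed

text \<open>The arguments of an instance are constructor terms, hence fixed by \<rho>, and the same
  \<open>ss\<close> appears on both sides. The symbol \<open>f\<close> is existential because \<rho>
  may identify symbols.\<close>

lemma instances_rename_iff:
  assumes "is_program S R"
  shows "CRule g ss r C \<in> instances S (rename_rule \<rho> ` R) \<longleftrightarrow>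
    (\<exists>f r' C'. CRule f ss r' C' \<in> instances S R \<and> g = \<rho> f \<and> r = rename_trm \<rho> r' \<and>
       C = map_prod (rename_trm \<rho>) (rename_trm \<rho>) ` C')"
proof
  have args: "map (rename_trm \<rho>) ss' = ss'" if "CRule f ss' r' C' \<in> instances S R" for f ss' r' C'
    using instancesD(2)[OF assms that] by (auto simp: tuples_def intro!: map_idI rename_trm_CTerm_bot)
  {
    assume "CRule g ss r C \<in> instances S (rename_rule \<rho> ` R)"
    then obtain p where p: "p \<in> instances S R" "CRule g ss r C = rename_rule \<rho> p"
      unfolding instances_rename by blast
    then show "\<exists>f r' C'. CRule f ss r' C' \<in> instances S R \<and> g = \<rho> f \<and> r = rename_trm \<rho> r' \<and>
        C = map_prod (rename_trm \<rho>) (rename_trm \<rho>) ` C'"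
      using args by (cases p) (auto simp: rename_rule_def)
  next
    assume "\<exists>f r' C'. CRule f ss r' C' \<in> instances S R \<and> g = \<rho> f \<and> r = rename_trm \<rho> r' \<and>
        C = map_prod (rename_trm \<rho>) (rename_trm \<rho>) ` C'"
    then obtain f r' C' where p: "CRule f ss r' C' \<in> instances S R" "g = \<rho> f"
      "r = rename_trm \<rho> r'" "C = map_prod (rename_trm \<rho>) (rename_trm \<rho>) ` C'" by blast
    then have "CRule g ss r C = rename_rule \<rho> (CRule f ss r' C')"
      using args by (simp add: rename_rule_def)
    then show "CRule g ss r C \<in> instances S (rename_rule \<rho> ` R)"
      unfolding instances_rename using p(1) by blast
  }
qed

text \<open>The reduct of \<open>A\<close> along \<rho>, restricted to \<open>FS S\<close> so that
  it can belong to the extensional function space \<open>TAlg S\<close>.\<close>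

definition pullback :: "('c, 'f) signature \<Rightarrow> ('f \<Rightarrow> 'f) \<Rightarrow> ('c, 'f, 'v) talg \<Rightarrow> ('c, 'f, 'v) talg" where
  "pullback S \<rho> A = (\<lambda>f\<in>FS S. A (\<rho> f))"

lemma pullback_TAlg:
  assumes "is_renaming S \<rho>" "A \<in> TAlg S"
  shows "pullback S \<rho> A \<in> TAlg S"
  unfolding TAlg_def pullback_def
proof (rule restrict_PiE_iff[THEN iffD2], rule ballI)
  fix f assume "f \<in> FS S"
  then have "\<rho> f \<in> FS S" "arF S (\<rho> f) = arF S f"
    using assms(1) by (auto simp: is_renaming_def)
  then show "A (\<rho> f) \<in> {F \<in> tuples S (arF S f) \<rightarrow>\<^sub>E cones S.
     monotone_on (tuples S (arF S f)) (list_all2 (approx S)) (\<subseteq>) F}"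
    using PiE_mem[OF assms(2)[unfolded TAlg_def], of "\<rho> f"] by simp
qed

text \<open>The usual reduct property. Membership in \<open>Term_bot S\<close> keeps all function
  symbols inside \<open>FS S\<close>, where \<open>pullback\<close> is given by \<rho>.\<close>

lemma eval_rename_trm:
  "e \<in> Term_bot S \<Longrightarrow> eval S A \<eta> (rename_trm \<rho> e) = eval S (pullback S \<rho> A) \<eta> e"
proof (induction e)
  case (Con c es)
  \<comment> \<open>Evaluation sees the arguments only through their list of values; the equation is
    kept at list level to rewrite with it.\<close>
  then have "map (eval S A \<eta> \<circ> rename_trm \<rho>) es = map (eval S (pullback S \<rho> A) \<eta>) es" by auto
  then show ?case by (simp del: map_eq_conv)
next
  case (Fun f es)
  then have "map (eval S A \<eta> \<circ> rename_trm \<rho>) es = map (eval S (pullback S \<rho> A) \<eta>) es" by auto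
  moreover have "pullback S \<rho> A f = A (\<rho> f)"
    using Fun.prems by (simp add: pullback_def)
  ultimately show ?case by (simp del: map_eq_conv)
qed auto

lemma models_rename:
  assumes "C \<subseteq> Term_bot S \<times> Term_bot S"
  shows "models S A \<eta> (map_prod (rename_trm \<rho>) (rename_trm \<rho>) ` C) \<longleftrightarrow>
    models S (pullback S \<rho> A) \<eta> C"
  using assms by (fastforce simp: models_def eval_rename_trm)

text \<open>The rules for \<open>g\<close> stem from the rules for all symbols of its fibre;
  \<open>insert Bot\<close> covers an empty fibre. The right-hand side mentions \<open>R\<close>
  only through \<open>T_op S R\<close>, which yields the congruence.\<close>

lemma T_op_rename:
  assumes "is_program S R" "is_renaming S \<rho>" "A \<in> TAlg S" "g \<in> FS S" "ts \<in> tuples S (arF S g)"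
  shows "T_op S (rename_rule \<rho> ` R) A g ts =
    insert Bot (\<Union>f\<in>{f \<in> FS S. \<rho> f = g}. T_op S R (pullback S \<rho> A) f ts)"
proof -
  have apply_pb: "T_op S R (pullback S \<rho> A) f ts = {t. \<exists>ss r C. CRule f ss r C \<in> instances S R \<and>
      list_all2 (approx S) ss ts \<and> models S (pullback S \<rho> A) Var C \<and>
      t \<in> eval S (pullback S \<rho> A) Var r} \<union> {Bot}" if "f \<in> FS S" "\<rho> f = g" for f
    using that assms by (intro T_op_apply pullback_TAlg) (auto simp: is_renaming_def)
  have "(\<exists>ss r C. CRule g ss r C \<in> instances S (rename_rule \<rho> ` R) \<and>
      list_all2 (approx S) ss ts \<and> models S A Var C \<and> t \<in> eval S A Var r) \<longleftrightarrow>
    (\<exists>f\<in>{f \<in> FS S. \<rho> f = g}. \<exists>ss r C. CRule f ss r C \<in> instances S R \<and>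
      list_all2 (approx S) ss ts \<and> models S (pullback S \<rho> A) Var C \<and>
      t \<in> eval S (pullback S \<rho> A) Var r)" (is "?L = ?R") for t
  proof
    assume ?L
    then obtain f ss r C where *: "CRule f ss r C \<in> instances S R" "g = \<rho> f"
      "list_all2 (approx S) ss ts" "models S A Var (map_prod (rename_trm \<rho>) (rename_trm \<rho>) ` C)"
      "t \<in> eval S A Var (rename_trm \<rho> r)"
      unfolding instances_rename_iff[OF assms(1)] by blast
    note D = instancesD[OF assms(1) *(1)]
    show ?R
      using * D(1) by (auto simp: models_rename[OF D(4)] eval_rename_trm[OF D(3)])
  next
    assume ?R
    then obtain f ss r C where *: "CRule f ss r C \<in> instances S R" "g = \<rho> f"
      "list_all2 (approx S) ss ts" "models S (pullback S \<rho> A) Var C"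
      "t \<in> eval S (pullback S \<rho> A) Var r" by blast
    note D = instancesD[OF assms(1) *(1)]
    have "models S A Var (map_prod (rename_trm \<rho>) (rename_trm \<rho>) ` C)"
      "t \<in> eval S A Var (rename_trm \<rho> r)"
      using * by (auto simp: models_rename[OF D(4)] eval_rename_trm[OF D(3)])
    with *(1-3) show ?L
      unfolding instances_rename_iff[OF assms(1)] by blast
  qed
  then show ?thesis
    unfolding T_op_apply[OF assms(3-5)] by (auto simp: apply_pb)
qed

theorem corollary5p7:
  fixes S :: "('c, 'f) signature"
  assumes "is_signature S"
    and "countable (UNIV :: 'v set)" and "infinite (UNIV :: 'v set)"
  shows "(\<forall>P Q :: ('c, 'f, 'v) prog_module. P \<in> Modules S \<and> Q \<in> Modules S \<longrightarrow>
            T_equiv S P Q \<longrightarrow> Ob S P = Ob S Q) \<and>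
         (\<forall>P1 P2 Q1 Q2 :: ('c, 'f, 'v) prog_module.
            P1 \<in> Modules S \<and> P2 \<in> Modules S \<and> Q1 \<in> Modules S \<and> Q2 \<in> Modules S \<longrightarrow>
            T_equiv S P1 Q1 \<and> T_equiv S P2 Q2 \<longrightarrow> T_equiv S (mod_union P1 P2) (mod_union Q1 Q2)) \<and>
         (\<forall>P Q :: ('c, 'f, 'v) prog_module. P \<in> Modules S \<and> Q \<in> Modules S \<longrightarrow>
            T_equiv S P Q \<longrightarrow>
              (\<forall>\<sigma>. \<sigma> \<subseteq> FS S \<longrightarrow> T_equiv S (mod_closure S \<sigma> P) (mod_closure S \<sigma> Q)) \<and>
              (\<forall>\<sigma>. \<sigma> \<subseteq> FS S \<longrightarrow> T_equiv S (mod_delete \<sigma> P) (mod_delete \<sigma> Q)) \<and>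
              (\<forall>\<rho>. is_renaming S \<rho> \<longrightarrow> T_equiv S (mod_rename \<rho> P) (mod_rename \<rho> Q)))"
proof (intro conjI allI impI; (elim conjE)?)
  \<comment> \<open>Observation, closure, deletion and renaming share their hypotheses and are
    proved in one block.\<close>
  fix P Q :: "('c, 'f, 'v) prog_module"
  assume PQ: "P \<in> Modules S" "Q \<in> Modules S" "T_equiv S P Q"
  then have prog: "is_program S (rl P)" "is_program S (rl Q)" and T: "T_op S (rl P) = T_op S (rl Q)"
    by (auto simp: Modules_program T_equiv_def)
  have M: "M_alg S (rl P) = M_alg S (rl Q)"
    by (rule M_alg_cong[OF prog T])
  then show "Ob S P = Ob S Q"
    by (simp add: Ob_def)
  show "T_equiv S (mod_closure S \<sigma> P) (mod_closure S \<sigma> Q)" if "\<sigma> \<subseteq> FS S" for \<sigma>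
    using mod_closure_cong[OF M that] by (simp add: T_equiv_def)
  show "T_equiv S (mod_delete \<sigma> P) (mod_delete \<sigma> Q)" for \<sigma>
    unfolding T_equiv_def mod_delete_def rl_module_of
    by (intro T_op_eqI) (simp add: T_op_delete T)
  show "T_equiv S (mod_rename \<rho> P) (mod_rename \<rho> Q)" if "is_renaming S \<rho>" for \<rho>
    unfolding T_equiv_def mod_rename_def rl_module_of
    by (intro T_op_eqI) (simp add: T_op_rename prog that T)
next
  fix P1 P2 Q1 Q2 :: "('c, 'f, 'v) prog_module"
  assume "T_equiv S P1 Q1" "T_equiv S P2 Q2"
  then show "T_equiv S (mod_union P1 P2) (mod_union Q1 Q2)"
    unfolding T_equiv_def mod_union_def rl_module_of
    by (intro T_op_eqI) (simp add: T_op_Un)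
qed

end
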